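(* Let $\tau$ be a cardinal and assume $MA(\tau)$. Let $G$ be a CHART group (compact Hausdorff admissible right topological group). If $w(G)\leq\tau$, then $G$ is a topological group.
   Context: A group $G$ with a topology is called right topological if all right shifts $\rho_h: G\to G$, $g\mapsto gh$ ($h\in G$), are continuous. The topological center $\Lambda(G)$ is the set of all $g\in G$ for which the left shift $\lambda_g: G\to G$, $h\mapsto gh$, is continuous. A right topological group $G$ is admissible if $\Lambda(G)$ is dense in $G$. A CHART group is a compact Hausdorff admissible right topological group. The weight $w(X)$ of a space $X$ is the least cardinality of a base for $X$. A space is ccc if every pairwise disjoint collection of its nonempty open subsets is countable. $MA(\tau)$ is the statement: if $X$ is a nonempty compact Hausdorff ccc space, then $X$ is not the union of $\tau$ or fewer nowhere dense subsets. *)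

theory Defs
  imports "HOL-Analysis.Analysis" "HOL-Algebra.Group"
begin

unbundle cardinal_syntax

section \<open>Groups with a topology\<close>

locale group_with_topology = group G
  for G (structure) and T :: "'a topology" +
  assumes topspace_eq_carrier: "topspace T = carrier G"

locale right_topological_group = group_with_topology +
  assumes continuous_right_shift:
    "h \<in> carrier G \<Longrightarrow> continuous_map T T (\<lambda>g. g \<otimes> h)"

definition topological_center :: "('a, 'm) monoid_scheme \<Rightarrow> 'a topology \<Rightarrow> 'a set" where
  "topological_center G T =
     {g \<in> carrier G. continuous_map T T (\<lambda>h. g \<otimes>\<^bsub>G\<^esub> h)}"

locale admissible_right_topological_group = right_topological_group +
  assumes topological_center_dense:
    "T closure_of (topological_center G T) = topspace T"

locale CHART_group = admissible_right_topological_group +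
  assumes compact: "compact_space T"
    and Hausdorff: "Hausdorff_space T"

locale topological_group = group_with_topology +
  assumes continuous_mult:
      "continuous_map (prod_topology T T) T (\<lambda>(g, h). g \<otimes> h)"
    and continuous_inv: "continuous_map T T (\<lambda>g. inv g)"

section \<open>Weight\<close>

definition is_base :: "'a topology \<Rightarrow> 'a set set \<Rightarrow> bool" where
  "is_base X \<B> \<longleftrightarrow> openin X = arbitrary union_of (\<lambda>U. U \<in> \<B>)"

definition weight :: "'a topology \<Rightarrow> 'a set rel" where
  "weight X = |SOME \<B>. is_base X \<B> \<and> (\<forall>\<B>'. is_base X \<B>' \<longrightarrow> |\<B>| \<le>o |\<B>'| )|"

lemma is_base_openin: "is_base X {U. openin X U}"
proof -
  have "(arbitrary union_of openin X) U \<longleftrightarrow> openin X U" for U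
  proof
    show "(arbitrary union_of openin X) U \<Longrightarrow> openin X U"
      by (auto simp: union_of_def)
    show "openin X U \<Longrightarrow> (arbitrary union_of openin X) U"
      by (rule union_of_inc) (auto simp: arbitrary_def)
  qed
  then show ?thesis
    by (auto simp: is_base_def)
qed

lemma weight_attained:
  obtains \<B> where "is_base X \<B>" "weight X = |\<B>|"
    "\<And>\<B>'. is_base X \<B>' \<Longrightarrow> |\<B>| \<le>o |\<B>'|"
proof -
  let ?R = "{ |\<B>| | \<B>. is_base X \<B>}"
  have "?R \<noteq> {}" "\<forall>r\<in>?R. Card_order r"
    using is_base_openin[of X] by (auto simp: card_of_Card_order)
  then obtain r where "r \<in> ?R" "\<forall>r'\<in>?R. r \<le>o r'"
    using exists_minim_Card_order[of ?R] by blast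
  then have "\<exists>\<B>. is_base X \<B> \<and> (\<forall>\<B>'. is_base X \<B>' \<longrightarrow> |\<B>| \<le>o |\<B>'| )"
    by blast
  from someI_ex[OF this] that show thesis
    unfolding weight_def by blast
qed

section \<open>Martin's axiom\<close>

definition ccc_space :: "'a topology \<Rightarrow> bool" where
  "ccc_space X \<longleftrightarrow>
     (\<forall>\<U>. (\<forall>U\<in>\<U>. openin X U \<and> U \<noteq> {}) \<and> pairwise disjnt \<U> \<longrightarrow> countable \<U>)"

definition nowhere_dense_in :: "'a topology \<Rightarrow> 'a set \<Rightarrow> bool" where
  "nowhere_dense_in X S \<longleftrightarrow> S \<subseteq> topspace X \<and> X interior_of (X closure_of S) = {}"

text \<open>
  HOL cannot quantify over all types inside a formula, so Martin's axiom is stated relative to an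
  ambient type \<open>'u\<close>: it speaks about all spaces whose points form a subset of \<open>'u\<close>. This is implied
  by the axiom for all spaces. If \<open>'u\<close> has at least \<open>2\<^sup>\<tau>\<close> elements, it also implies the axiom for all
  spaces: by a Loewenheim-Skolem argument, a failure of the axiom for uncountable \<open>\<tau>\<close> is witnessed
  by a space of weight at most \<open>\<tau>\<close>, and such a Hausdorff space has at most \<open>2\<^sup>\<tau>\<close> points (for countable
  \<open>\<tau>\<close> both hold by the Baire category theorem). Without such a bound the relative axiom may hold
  trivially: over a countable \<open>'u\<close> it holds for every \<open>\<tau>\<close>.
\<close>

definition MA :: "'u itself \<Rightarrow> 'c rel \<Rightarrow> bool" where
  "MA _ \<tau> \<longleftrightarrow>
     (\<forall>X :: 'u topology.
        topspace X \<noteq> {} \<and> compact_space X \<and> Hausdorff_space X \<and> ccc_space X \<longrightarrow>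
        \<not> (\<exists>\<N>. |\<N>| \<le>o \<tau> \<and> (\<forall>N\<in>\<N>. nowhere_dense_in X N) \<and> topspace X = \<Union>\<N>))"

end

theory Submission
  imports Defs "HOL-Algebra.Free_Abelian_Groups"
begin

text \<open>
  It suffices to show that the multiplication is jointly continuous at every point \<open>(g, \<one>)\<close>: right
  shifts are homeomorphisms, so they carry this to all points, and inversion is continuous because its
  graph is a closed subset of a compact square (\<open>topological_groupI_local\<close>).

  Suppose that joint continuity fails at \<open>(g\<^sub>0, \<one>)\<close>. A Urysohn function \<open>f\<close> then jumps: every
  neighbourhood of \<open>\<one>\<close> contains some \<open>h\<close> such that \<open>f g < 1/4\<close> and \<open>f (g \<otimes> h) > 3/4\<close> for some
  \<open>g\<close>, and both can be taken in the topological center \<open>\<Lambda>\<close> by density. Martin's axiom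
  needs a ccc space, so the failure is first reflected to a countable set. A Loewenheim-Skolem closure
  (\<open>countable_subgroup_of_jumps\<close>) produces a countable subgroup \<open>D \<subseteq> \<Lambda>\<close> in which such \<open>g\<close> and
  \<open>h\<close> occur with \<open>f (p \<otimes> h)\<close> arbitrarily close to \<open>f p\<close> on any prescribed finite set of \<open>p \<in> D\<close>.

  Let \<open>\<Phi>\<close> map \<open>h\<close> to the function \<open>p \<mapsto> f (p \<otimes> h)\<close> on \<open>D\<close>. It is continuous since \<open>D \<subseteq> \<Lambda>\<close>, and
  the image \<open>K\<close> of the closure of \<open>D\<close> is a compact subset of \<open>\<real>\<^sup>D\<close> in which \<open>\<Phi> ` D\<close> is dense and
  countable; so \<open>K\<close> is ccc and Martin's axiom applies to it. For every \<open>h\<close> the function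
  \<open>g \<mapsto> f (g \<otimes> h)\<close> is continuous on the whole compact group, so some finite union \<open>E\<close> of basic open
  sets lies between \<open>{g. f (g \<otimes> h) \<le> 1/4}\<close> and \<open>{g. f (g \<otimes> h) < 3/4}\<close>. There are at most \<open>\<tau>\<close> such
  \<open>E\<close>, and those \<open>x \<in> K\<close> with \<open>x \<le> 3/4\<close> on \<open>D \<inter> E\<close> and \<open>x \<ge> 1/4\<close> on \<open>D - E\<close> form a closed set.
  These sets cover \<open>K\<close>, so one of them has an interior point \<open>\<Phi> u\<close> with \<open>u \<in> D\<close>. By the choice of
  \<open>D\<close> there are \<open>g, h \<in> D\<close> with \<open>f g < 1/4\<close>, \<open>f (g \<otimes> h) > 3/4\<close> and \<open>\<Phi> (u \<otimes> h)\<close> so close to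
  \<open>\<Phi> u\<close> that it lies in the same set. At the index \<open>g \<otimes> inv u\<close> the two points take the values
  \<open>f g\<close> and \<open>f (g \<otimes> h)\<close>, so this index can be neither in \<open>E\<close> nor outside it
  (\<open>MA_jointly_continuous_at_one\<close>).

  Finite \<open>\<tau>\<close> is treated separately: the topology is then finite, hence \<open>{\<one>}\<close> is open and joint
  continuity at \<open>(g, \<one>)\<close> is immediate.
\<close>

section \<open>Martin's axiom for separable spaces\<close>

lemma separable_space_imp_ccc_space:
  assumes "separable_space X"
  shows "ccc_space X"
  unfolding ccc_space_def
proof (intro allI impI, elim conjE)
  fix \<U> assume ne: "\<forall>U\<in>\<U>. openin X U \<and> U \<noteq> {}" and dj: "pairwise disjnt \<U>"
  obtain C where C: "countable C" "X closure_of C = topspace X"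
    using assms by (auto simp: separable_space_def)
  have "\<forall>U\<in>\<U>. \<exists>c. c \<in> C \<inter> U"
    using C(2) ne by (meson dense_intersects_open ex_in_conv)
  then obtain c where c: "\<And>U. U \<in> \<U> \<Longrightarrow> c U \<in> C \<inter> U"
    by metis
  have "inj_on c \<U>"
  proof (rule inj_onI, rule ccontr)
    fix U V assume UV: "U \<in> \<U>" "V \<in> \<U>" "c U = c V" "U \<noteq> V"
    then have "c U \<in> U \<inter> V" using c by force
    then show False using dj UV by (auto simp: pairwise_def disjnt_def)
  qed
  moreover have "c ` \<U> \<subseteq> C" using c by auto
  ultimately show "countable \<U>"
    using C(1) by (metis countable_image_inj_eq countable_subset)
qed

lemma homeomorphic_map_ccc_space:
  assumes hom: "homeomorphic_map X Y f" and "ccc_space X"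
  shows "ccc_space Y"
  unfolding ccc_space_def
proof (intro allI impI, elim conjE)
  fix \<U> assume ne: "\<forall>U\<in>\<U>. openin Y U \<and> U \<noteq> {}" and dj: "pairwise disjnt \<U>"
  define pre where "pre = (\<lambda>U. {x \<in> topspace X. f x \<in> U})"
  have f: "continuous_map X Y f" "f ` topspace X = topspace Y"
    using hom by (auto simp: homeomorphic_eq_everything_map)
  have img: "f ` pre U = U" if "U \<in> \<U>" for U
  proof -
    have "U \<subseteq> f ` topspace X" using ne that f(2) openin_subset by metis
    then show ?thesis by (auto simp: pre_def)
  qed
  have "openin X (pre U) \<and> pre U \<noteq> {}" if "U \<in> \<U>" for U
  proof
    show "openin X (pre U)"
      unfolding pre_def using ne that by (intro openin_continuous_map_preimage[OF f(1)]) blast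
    show "pre U \<noteq> {}" using img[OF that] ne that by auto
  qed
  then have "\<forall>V\<in>pre ` \<U>. openin X V \<and> V \<noteq> {}" by blast
  moreover have "pairwise disjnt (pre ` \<U>)"
    unfolding pairwise_image
    using dj by (auto simp: pairwise_def pre_def disjnt_def)
  ultimately have "countable (pre ` \<U>)"
    using assms(2) by (simp add: ccc_space_def)
  moreover have "\<U> = (\<lambda>V. f ` V) ` pre ` \<U>"
    unfolding image_image using img by simp
  ultimately show "countable \<U>"
    by (metis countable_image)
qed

text \<open>
  A space over the smaller type is transported along an injection into the larger one.
\<close>

lemma MA_mono_type:
  assumes MA: "MA TYPE('u) \<tau>" and le: "|UNIV :: 'b set| \<le>o |UNIV :: 'u set|"
  shows "MA TYPE('b) \<tau>"
  unfolding MA_def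
proof (intro allI impI notI, elim conjE exE)
  fix X :: "'b topology" and \<N>
  assume X: "topspace X \<noteq> {}" "compact_space X" "Hausdorff_space X" "ccc_space X"
    and \<N>: "|\<N>| \<le>o \<tau>" "\<forall>N\<in>\<N>. nowhere_dense_in X N" "topspace X = \<Union>\<N>"
  obtain i :: "'b \<Rightarrow> 'u" where i: "inj i"
    using le card_of_ordLeq[of "UNIV :: 'b set" "UNIV :: 'u set"] by auto
  define Y where "Y = pullback_topology (range i) (inv_into UNIV i) X"
  have "homeomorphic_maps X Y i (inv_into UNIV i)"
    unfolding homeomorphic_maps_def
  proof (intro conjI ballI)
    show "continuous_map X Y i"
      unfolding Y_def using i by (intro continuous_map_pullback') (auto simp: comp_def)
    show "continuous_map Y X (inv_into UNIV i)"
      unfolding Y_def using continuous_map_pullback[of X X id "range i" "inv_into UNIV i"] by simp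
  qed (use i in \<open>auto simp: Y_def topspace_pullback_topology\<close>)
  then have hom: "homeomorphic_map X Y i"
    using homeomorphic_map_maps by blast
  then have hs: "X homeomorphic_space Y"
    using homeomorphic_map_imp_homeomorphic_space by blast
  have top: "topspace Y = i ` topspace X"
    using hom by (metis homeomorphic_imp_surjective_map)
  have "topspace Y \<noteq> {} \<and> compact_space Y \<and> Hausdorff_space Y \<and> ccc_space Y"
    using X top homeomorphic_compact_space[OF hs] homeomorphic_Hausdorff_space[OF hs]
      homeomorphic_map_ccc_space[OF hom] by auto
  then have no_cover: "\<not> (\<exists>\<N>. |\<N>| \<le>o \<tau> \<and> (\<forall>N\<in>\<N>. nowhere_dense_in Y N) \<and> topspace Y = \<Union>\<N>)"
    using MA by (simp add: MA_def)
  have "|(\<lambda>N. i ` N) ` \<N>| \<le>o \<tau>"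
    using \<N>(1) card_of_image ordLeq_transitive by blast
  moreover have "\<forall>M \<in> (\<lambda>N. i ` N) ` \<N>. nowhere_dense_in Y M"
  proof
    fix M assume "M \<in> (\<lambda>N. i ` N) ` \<N>"
    then obtain N where N: "M = i ` N" "N \<subseteq> topspace X" "X interior_of (X closure_of N) = {}"
      using \<N>(2) by (auto simp: nowhere_dense_in_def)
    then show "nowhere_dense_in Y M"
      using hom top
      by (simp add: nowhere_dense_in_def homeomorphic_map_closure_of homeomorphic_map_interior_of
          closure_of_subset_topspace image_mono)
  qed
  moreover have "topspace Y = \<Union>((\<lambda>N. i ` N) ` \<N>)"
    using top \<N>(3) by auto
  ultimately show False
    using exI[of "\<lambda>\<M>. |\<M>| \<le>o \<tau> \<and> (\<forall>M\<in>\<M>. nowhere_dense_in Y M) \<and> topspace Y = \<Union>\<M>"]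
      no_cover by (metis (no_types))
qed

text \<open>The form in which Martin's axiom is applied: a category argument for closed covers.\<close>

lemma MA_closed_cover_has_interior:
  fixes X :: "'b topology"
  assumes MA: "MA TYPE('b) \<tau>"
    and X: "topspace X \<noteq> {}" "compact_space X" "Hausdorff_space X" "ccc_space X"
    and I: "|I| \<le>o \<tau>"
    and closed: "\<And>i. i \<in> I \<Longrightarrow> closedin X (C i)"
    and cover: "topspace X \<subseteq> (\<Union>i\<in>I. C i)"
  obtains i where "i \<in> I" "X interior_of C i \<noteq> {}"
proof -
  have "\<not> (\<exists>\<N>. |\<N>| \<le>o \<tau> \<and> (\<forall>N\<in>\<N>. nowhere_dense_in X N) \<and> topspace X = \<Union>\<N>)"
    using MA X by (simp add: MA_def)
  moreover have "|C ` I| \<le>o \<tau>"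
    using I card_of_image ordLeq_transitive by blast
  moreover have "topspace X = \<Union>(C ` I)"
    using cover closed closedin_subset by fastforce
  ultimately have "\<not> (\<forall>N\<in>C ` I. nowhere_dense_in X N)"
    by blast
  then show thesis
    using closed that by (auto simp: nowhere_dense_in_def closure_of_closedin dest: closedin_subset)
qed

section \<open>Cardinality and closure arguments\<close>

text \<open>
  This size bound makes the real sequences available as an ambient type for Martin's axiom. A sequence
  is determined by the Dedekind cuts of its terms, that is, by a subset of \<open>\<nat> \<times> \<rat>\<close>.
\<close>

lemma card_of_nat_fun_real_ordLeq_Pow:
  assumes "infinite A"
  shows "|UNIV :: (nat \<Rightarrow> real) set| \<le>o |Pow A|"
proof -
  let ?cut = "\<lambda>\<phi> :: nat \<Rightarrow> real. {(n, q :: rat). of_rat q < \<phi> n}"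
  have "inj ?cut"
  proof (rule injI, rule ext)
    fix \<phi> \<psi> and n
    assume eq: "?cut \<phi> = ?cut \<psi>"
    have "of_rat q < \<phi> n \<longleftrightarrow> of_rat q < \<psi> n" for q
      using eq by (auto simp: set_eq_iff)
    then show "\<phi> n = \<psi> n"
      by (metis less_irrefl linorder_neqE_linordered_idom of_rat_dense order_less_trans)
  qed
  then have "|UNIV :: (nat \<Rightarrow> real) set| \<le>o |Pow (UNIV :: (nat \<times> rat) set)|"
    using card_of_ordLeq[of "UNIV :: (nat \<Rightarrow> real) set" "Pow (UNIV :: (nat \<times> rat) set)"] by auto
  moreover have "|UNIV :: (nat \<times> rat) set| \<le>o |A|"
  proof -
    have "|UNIV :: (nat \<times> rat) set| \<le>o |UNIV :: nat set|"
      using card_of_ordLeq[of "UNIV :: (nat \<times> rat) set" "UNIV :: nat set"]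
        inj_to_nat[where ?'a = "nat \<times> rat"] by blast
    then show ?thesis
      using assms infinite_iff_card_of_nat ordLeq_transitive by blast
  qed
  ultimately show ?thesis
    by (meson card_of_Pow_mono ordLeq_transitive)
qed

lemma card_of_Fpow_ordLeq_infinite:
  assumes "Card_order \<tau>" "infinite (Field \<tau>)" "|B| \<le>o \<tau>"
  shows "|Fpow B| \<le>o \<tau>"
proof -
  have "|B| \<le>o |Field \<tau>|"
    using assms(1,3) card_of_Field_ordIso ordIso_symmetric ordLeq_ordIso_trans by blast
  then have "|Fpow B| \<le>o |Fpow (Field \<tau>)|"
    by simp
  also have "|Fpow (Field \<tau>)| =o |Field \<tau>|"
    using assms(2) by simp
  also have "|Field \<tau>| =o \<tau>"
    using assms(1) by (rule card_of_Field_ordIso)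
  finally show ?thesis .
qed

lemma compactin_between_base:
  assumes base: "is_base X B" and K: "compactin X K" and W: "openin X W" "K \<subseteq> W"
  obtains F where "F \<in> Fpow B" "K \<subseteq> \<Union>F" "\<Union>F \<subseteq> W"
proof -
  obtain \<W> where \<W>: "\<W> \<subseteq> B" "W = \<Union>\<W>"
    using base W(1) by (auto simp: is_base_def union_of_def subset_iff)
  have "\<And>U. U \<in> \<W> \<Longrightarrow> openin X U"
    using \<W>(1) base by (auto simp: is_base_def subset_iff arbitrary_def intro!: union_of_inc)
  then obtain F where "finite F" "F \<subseteq> \<W>" "K \<subseteq> \<Union>F"
    using K W(2) \<W>(2) compactinD[of X K \<W>] by blast
  then show thesis
    using \<W> by (intro that[of F]) (auto simp: Fpow_def)
qed

text \<open>
  The downward Loewenheim-Skolem argument: \<open>F\<close> collects the values of countably many finitary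
  operations, and the set is closed off in \<open>\<omega>\<close> steps.
\<close>

lemma countable_closed_subset:
  fixes F :: "'a list \<Rightarrow> 'a set"
  assumes F: "\<And>xs. countable (F xs)" and L: "\<And>xs. set xs \<subseteq> L \<Longrightarrow> F xs \<subseteq> L"
  obtains D where "countable D" "D \<subseteq> L" "\<And>xs. set xs \<subseteq> D \<Longrightarrow> F xs \<subseteq> D"
proof -
  define S where "S = rec_nat {} (\<lambda>_ A. A \<union> (\<Union>xs\<in>lists A. F xs))"
  have S_simps: "S 0 = {}" "\<And>n. S (Suc n) = S n \<union> (\<Union>xs\<in>lists (S n). F xs)"
    by (simp_all add: S_def)
  have mono: "m \<le> n \<Longrightarrow> S m \<subseteq> S n" for m n
    by (rule lift_Suc_mono_le[of S]) (auto simp: S_simps)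
  have "countable (S n) \<and> S n \<subseteq> L" for n
  proof (induction n)
    case (Suc n)
    then have "countable (lists (S n))" by simp
    moreover have "F xs \<subseteq> L" if "xs \<in> lists (S n)" for xs
      using L[of xs] Suc that by (auto simp: lists_eq_set)
    ultimately show ?case
      using F Suc by (auto simp: S_simps)
  qed (simp add: S_simps)
  moreover have "F xs \<subseteq> (\<Union>n. S n)" if "set xs \<subseteq> (\<Union>n. S n)" for xs
  proof -
    have "\<exists>n. set xs \<subseteq> S n"
      using that
    proof (induction xs)
      case (Cons x xs)
      then obtain m n where "x \<in> S m" "set xs \<subseteq> S n" by auto
      then have "set (x # xs) \<subseteq> S (max m n)"
        using mono[of m "max m n"] mono[of n "max m n"] by auto
      then show ?case ..
    qed simp
    then obtain n where "xs \<in> lists (S n)" by (auto simp: lists_eq_set)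
    then have "F xs \<subseteq> S (Suc n)" by (auto simp: S_simps)
    then show ?thesis by blast
  qed
  ultimately show thesis
    by (intro that[of "\<Union>n. S n"]) auto
qed

section \<open>Groups with continuous right shifts\<close>

context CHART_group
begin

lemma openin_right_shift_vimage:
  assumes "openin T W" "h \<in> carrier G"
  shows "openin T {g \<in> carrier G. g \<otimes> h \<in> W}"
  using openin_continuous_map_preimage[OF continuous_right_shift assms(1)] assms(2)
  by (simp add: topspace_eq_carrier)

lemma openin_left_shift_vimage:
  assumes "openin T W" "g \<in> topological_center G T"
  shows "openin T {h \<in> carrier G. g \<otimes> h \<in> W}"
  using openin_continuous_map_preimage[of T T "\<lambda>h. g \<otimes> h" W] assms
  by (simp add: topspace_eq_carrier topological_center_def)

text \<open>
  Closure under inverses is where compactness enters: left shift by a central element is a continuous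
  bijection of a compact Hausdorff space, hence a homeomorphism.
\<close>

lemma topological_center_subgroup: "subgroup (topological_center G T) G"
proof (unfold_locales)
  show "topological_center G T \<subseteq> carrier G" by (auto simp: topological_center_def)
next
  fix x y assume x: "x \<in> topological_center G T" and y: "y \<in> topological_center G T"
  have xy: "x \<in> carrier G" "y \<in> carrier G"
    using x y by (auto simp: topological_center_def)
  have "continuous_map T T ((\<lambda>h. x \<otimes> h) \<circ> (\<lambda>h. y \<otimes> h))"
    using x y by (intro continuous_map_compose) (auto simp: topological_center_def)
  then have "continuous_map T T (\<lambda>h. x \<otimes> y \<otimes> h)"
    by (rule continuous_map_eq) (use xy in \<open>simp add: topspace_eq_carrier m_assoc\<close>)
  then show "x \<otimes> y \<in> topological_center G T"
    using xy by (simp add: topological_center_def)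
next
  have "continuous_map T T (\<lambda>h. \<one> \<otimes> h)"
    by (rule continuous_map_eq[OF continuous_map_id]) (simp add: topspace_eq_carrier)
  then show "\<one> \<in> topological_center G T"
    by (simp add: topological_center_def)
next
  fix x assume x: "x \<in> topological_center G T"
  then have xc: "x \<in> carrier G" by (auto simp: topological_center_def)
  have inj: "inj_on (\<lambda>h. x \<otimes> h) (topspace T)"
    using xc by (auto simp: inj_on_def topspace_eq_carrier)
  have surj: "(\<lambda>h. x \<otimes> h) ` topspace T = topspace T"
  proof -
    have "h \<in> (\<lambda>h. x \<otimes> h) ` carrier G" if "h \<in> carrier G" for h
      using that xc by (intro image_eqI[of _ _ "inv x \<otimes> h"]) (simp_all add: m_assoc[symmetric])
    then show ?thesis using xc by (auto simp: topspace_eq_carrier)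
  qed
  have "homeomorphic_map T T (\<lambda>h. x \<otimes> h)"
    using x compact Hausdorff inj surj
    by (intro continuous_imp_homeomorphic_map) (auto simp: topological_center_def)
  then have open_img: "openin T ((\<lambda>h. x \<otimes> h) ` U)" if "openin T U" for U
    using that homeomorphic_map_openness openin_subset by metis
  have "continuous_map T T (\<lambda>h. inv x \<otimes> h)"
    unfolding continuous_map_def
  proof (intro conjI allI impI)
    show "(\<lambda>h. inv x \<otimes> h) \<in> topspace T \<rightarrow> topspace T"
      using xc by (auto simp: topspace_eq_carrier)
    fix U assume U: "openin T U"
    then have Uc: "U \<subseteq> carrier G" using openin_subset topspace_eq_carrier by metis
    have "{h \<in> topspace T. inv x \<otimes> h \<in> U} = (\<lambda>h. x \<otimes> h) ` U"
    proof (intro equalityI subsetI)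
      fix h assume "h \<in> {h \<in> topspace T. inv x \<otimes> h \<in> U}"
      then show "h \<in> (\<lambda>h. x \<otimes> h) ` U"
        using xc by (intro image_eqI[of _ _ "inv x \<otimes> h"])
          (simp_all add: m_assoc[symmetric] topspace_eq_carrier)
    next
      fix h assume "h \<in> (\<lambda>h. x \<otimes> h) ` U"
      then obtain u where u: "u \<in> U" "h = x \<otimes> u" by auto
      then show "h \<in> {h \<in> topspace T. inv x \<otimes> h \<in> U}"
        using xc subsetD[OF Uc u(1)] by (simp add: m_assoc[symmetric] topspace_eq_carrier)
    qed
    then show "openin T {h \<in> topspace T. inv x \<otimes> h \<in> U}"
      using open_img[OF U] by simp
  qed
  then show "inv x \<in> topological_center G T"
    using xc by (simp add: topological_center_def)
qed

text \<open>
  Continuity at \<open>(g, \<one>)\<close> gives continuity at \<open>(g, k)\<close>, because \<open>x \<otimes> h = (x \<otimes> (h \<otimes> inv k)) \<otimes> k\<close> and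
  right shifts are continuous. Then \<open>{(g, h). g \<otimes> h = \<one>}\<close> is closed, and the preimage of a closed
  set \<open>C\<close> under inversion is the projection of its part over \<open>C\<close>; projections along a compact
  factor are closed.
\<close>

lemma topological_groupI_local:
  assumes local: "\<And>W g. openin T W \<Longrightarrow> g \<in> W \<Longrightarrow>
    \<exists>N V. openin T N \<and> openin T V \<and> g \<in> N \<and> \<one> \<in> V \<and> (\<forall>x\<in>N. \<forall>h\<in>V. x \<otimes> h \<in> W)"
  shows "topological_group G T"
proof unfold_locales
  show mult: "continuous_map (prod_topology T T) T (\<lambda>(g, h). g \<otimes> h)"
    unfolding continuous_map_def
  proof (intro conjI allI impI)
    show "(\<lambda>(g, h). g \<otimes> h) \<in> topspace (prod_topology T T) \<rightarrow> topspace T"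
      by (auto simp: topspace_eq_carrier)
    fix W assume W: "openin T W"
    show "openin (prod_topology T T)
        {z \<in> topspace (prod_topology T T). (case z of (g, h) \<Rightarrow> g \<otimes> h) \<in> W}"
      unfolding openin_prod_topology_alt
    proof (intro allI impI)
      fix g k assume gk: "(g, k) \<in> {z \<in> topspace (prod_topology T T). (case z of (g, h) \<Rightarrow> g \<otimes> h) \<in> W}"
      then have c: "g \<in> carrier G" "k \<in> carrier G" "g \<otimes> k \<in> W"
        by (auto simp: topspace_eq_carrier)
      obtain N V where NV: "openin T N" "openin T V" "g \<in> N" "\<one> \<in> V"
        "\<forall>x\<in>N. \<forall>h\<in>V. x \<otimes> h \<in> {x \<in> carrier G. x \<otimes> k \<in> W}"
        using local[OF openin_right_shift_vimage[OF W c(2)], of g] c by auto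
      let ?V = "{h \<in> carrier G. h \<otimes> inv k \<in> V}"
      have "openin T ?V" "k \<in> ?V"
        using openin_right_shift_vimage[OF NV(2), of "inv k"] c NV(4) by auto
      moreover have "x \<otimes> h \<in> W" if "x \<in> N" "h \<in> ?V" for x h
      proof -
        have "x \<in> carrier G"
          using that NV(1) openin_subset topspace_eq_carrier by blast
        then have "x \<otimes> (h \<otimes> inv k) \<otimes> k = x \<otimes> h"
          using that c by (simp add: m_assoc)
        then show ?thesis
          using NV(5) that by fastforce
      qed
      ultimately show "\<exists>U V. openin T U \<and> openin T V \<and> g \<in> U \<and> k \<in> V \<and>
          U \<times> V \<subseteq> {z \<in> topspace (prod_topology T T). (case z of (g, h) \<Rightarrow> g \<otimes> h) \<in> W}"
        using NV(1,3) openin_subset[OF NV(1)]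
        by (intro exI[of _ N] exI[of _ ?V]) (auto simp: topspace_eq_carrier)
    qed
  qed
  have one: "closedin T {\<one>}"
    using Hausdorff by (simp add: Hausdorff_imp_t1_space closedin_t1_singleton topspace_eq_carrier)
  show "continuous_map T T (\<lambda>g. inv g)"
    unfolding continuous_map_closedin
  proof (intro conjI allI impI)
    show "(\<lambda>g. inv g) \<in> topspace T \<rightarrow> topspace T"
      by (auto simp: topspace_eq_carrier)
    fix C assume C: "closedin T C"
    let ?E = "{z \<in> topspace (prod_topology T T). (case z of (g, h) \<Rightarrow> g \<otimes> h) \<in> {\<one>}}"
    have "closedin (prod_topology T T) (?E \<inter> topspace T \<times> C)"
      using closedin_continuous_map_preimage[OF mult one] C
      by (intro closedin_Int) (auto simp: closedin_prod_Times_iff)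
    then have "closedin T (fst ` (?E \<inter> topspace T \<times> C))"
      using closed_map_fst[OF compact, of T] by (auto simp: closed_map_def)
    moreover have "fst ` (?E \<inter> topspace T \<times> C) = {g \<in> topspace T. inv g \<in> C}"
    proof (intro equalityI subsetI)
      fix g assume "g \<in> fst ` (?E \<inter> topspace T \<times> C)"
      then obtain h where h: "g \<in> carrier G" "h \<in> carrier G" "g \<otimes> h = \<one>" "h \<in> C"
        by (auto simp: topspace_eq_carrier)
      then have "inv g = h" by (metis inv_equality inv_inv)
      then show "g \<in> {g \<in> topspace T. inv g \<in> C}"
        using h by (simp add: topspace_eq_carrier)
    next
      fix g assume "g \<in> {g \<in> topspace T. inv g \<in> C}"
      then show "g \<in> fst ` (?E \<inter> topspace T \<times> C)"
        by (intro image_eqI[of _ _ "(g, inv g)"]) (auto simp: topspace_eq_carrier)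
    qed
    ultimately show "closedin T {g \<in> topspace T. inv g \<in> C}" by simp
  qed
qed

text \<open>
  Reflection of a discontinuity to a countable subgroup. For a finite set of central elements \<open>p\<close> the
  maps \<open>h \<mapsto> f (p \<otimes> h)\<close> are continuous, so closeness of \<open>f (p \<otimes> h)\<close> to \<open>f p\<close> holds on a
  neighbourhood of \<open>\<one>\<close>, where the hypothesis supplies a jump. The subgroup is obtained by closing
  off under the group operations and a choice of these jumps.
\<close>

lemma countable_subgroup_of_jumps:
  fixes f :: "'a \<Rightarrow> real"
  assumes f: "continuous_map T euclideanreal f"
    and jump: "\<And>V. openin T V \<Longrightarrow> \<one> \<in> V \<Longrightarrow>
      \<exists>g\<in>topological_center G T. \<exists>h\<in>topological_center G T. h \<in> V \<and> f g < 1/4 \<and> f (g \<otimes> h) > 3/4"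
  obtains D where "countable D" "D \<subseteq> topological_center G T" "subgroup D G"
    "\<And>P \<epsilon>. finite P \<Longrightarrow> P \<subseteq> D \<Longrightarrow> \<epsilon> > 0 \<Longrightarrow>
       \<exists>g\<in>D. \<exists>h\<in>D. (\<forall>p\<in>P. \<bar>f (p \<otimes> h) - f p\<bar> < \<epsilon>) \<and> f g < 1/4 \<and> f (g \<otimes> h) > 3/4"
proof -
  let ?L = "topological_center G T"
  interpret L: subgroup ?L G by (rule topological_center_subgroup)
  let ?J = "\<lambda>xs n g h. g \<in> ?L \<and> h \<in> ?L \<and> (\<forall>p\<in>set xs. \<bar>f (p \<otimes> h) - f p\<bar> < 1 / Suc n) \<and>
    f g < 1/4 \<and> f (g \<otimes> h) > 3/4"
  have ex: "\<exists>g h. ?J xs n g h" if xs: "set xs \<subseteq> ?L" for xs and n :: nat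
  proof -
    define U where "U p = {x \<in> topspace T. f x \<in> {f p - 1 / Suc n <..< f p + 1 / Suc n}}" for p
    define V where "V = (\<Inter>p\<in>set xs. {h \<in> carrier G. p \<otimes> h \<in> U p}) \<inter> topspace T"
    have "openin T (U p)" for p
      unfolding U_def by (rule openin_continuous_map_preimage[OF f]) simp
    then have "openin T V"
      unfolding V_def using xs by (intro openin_INT openin_left_shift_vimage) auto
    moreover have "\<one> \<in> V"
      using xs by (auto simp: V_def U_def topspace_eq_carrier)
    ultimately obtain g h where gh: "g \<in> ?L" "h \<in> ?L" "h \<in> V" "f g < 1/4" "f (g \<otimes> h) > 3/4"
      using jump[of V] by auto
    have "\<bar>f (p \<otimes> h) - f p\<bar> < 1 / Suc n" if "p \<in> set xs" for p
    proof -
      have "p \<otimes> h \<in> U p" using gh(3) that by (simp add: V_def)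
      then show ?thesis by (auto simp: U_def abs_less_iff)
    qed
    then show ?thesis using gh by blast
  qed
  define a where "a xs n = (SOME g. \<exists>h. ?J xs n g h)" for xs n
  define b where "b xs n = (SOME h. ?J xs n (a xs n) h)" for xs n
  have ab: "?J xs n (a xs n) (b xs n)" if "set xs \<subseteq> ?L" for xs n
  proof -
    have "\<exists>h. ?J xs n (a xs n) h"
      unfolding a_def using ex[OF that, of n] by (rule someI_ex)
    then show ?thesis
      unfolding b_def by (rule someI_ex)
  qed
  define F where "F xs = {\<one>} \<union> m_inv G ` set xs \<union> (\<lambda>(x, y). x \<otimes> y) ` (set xs \<times> set xs)
    \<union> range (a xs) \<union> range (b xs)" for xs
  have F_countable: "countable (F xs)" for xs
    unfolding F_def by (intro countable_Un countable_image countable_SIGMA) (auto intro: countable_finite)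
  have F_center: "F xs \<subseteq> ?L" if "set xs \<subseteq> ?L" for xs
    unfolding F_def using that ab[OF that] by auto
  obtain D where D: "countable D" "D \<subseteq> ?L" "\<And>xs. set xs \<subseteq> D \<Longrightarrow> F xs \<subseteq> D"
    using countable_closed_subset[of F ?L, OF F_countable F_center] by metis
  have "subgroup D G"
  proof
    show "D \<subseteq> carrier G" using D(2) L.subset by blast
    show "\<one> \<in> D" using D(3)[of "[]"] by (auto simp: F_def)
    show "x \<otimes> y \<in> D" if "x \<in> D" "y \<in> D" for x y
      using D(3)[of "[x, y]"] that by (auto simp: F_def)
    show "inv x \<in> D" if "x \<in> D" for x
      using D(3)[of "[x]"] that by (auto simp: F_def)
  qed
  moreover have "\<exists>g\<in>D. \<exists>h\<in>D. (\<forall>p\<in>P. \<bar>f (p \<otimes> h) - f p\<bar> < \<epsilon>) \<and> f g < 1/4 \<and> f (g \<otimes> h) > 3/4"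
    if P: "finite P" "P \<subseteq> D" and \<epsilon>: "\<epsilon> > 0" for P \<epsilon>
  proof -
    obtain xs where xs: "set xs = P" using P(1) finite_list by blast
    obtain n where n: "1 / Suc n < \<epsilon>" using \<epsilon> nat_approx_posE by blast
    have "a xs n \<in> D" "b xs n \<in> D"
      using D(3)[of xs] P xs by (auto simp: F_def)
    moreover have "?J xs n (a xs n) (b xs n)"
      using ab P(2) D(2) xs by blast
    ultimately show ?thesis
      using xs n by (meson less_trans)
  qed
  ultimately show thesis
    using that D by blast
qed

text \<open>
  The category argument. It takes place in the compact set \<open>K\<close> of real sequences, where coordinate
  \<open>n\<close> stands for the \<open>n\<close>-th element of a countable subgroup \<open>D\<close> of the center. Every nonempty open
  subset of \<open>K\<close> contains some \<open>\<Phi> u\<close> with \<open>u \<in> D\<close>, and translating the jumps of \<open>f\<close> by \<open>u\<close> shows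
  that arbitrarily near \<open>\<Phi> u\<close> there are points of \<open>\<Phi> ` D\<close> differing from it by more than \<open>1/2\<close> in
  some coordinate; yet \<open>K\<close> is covered by few closed sets none of which contains such a pair.
\<close>

lemma MA_jointly_continuous_at_one:
  assumes MA: "MA TYPE(nat \<Rightarrow> real) \<tau>"
    and base: "is_base T B" and card: "|Fpow B| \<le>o \<tau>"
    and W: "openin T W" "g\<^sub>0 \<in> W"
  shows "\<exists>N V. openin T N \<and> openin T V \<and> g\<^sub>0 \<in> N \<and> \<one> \<in> V \<and> (\<forall>x\<in>N. \<forall>h\<in>V. x \<otimes> h \<in> W)"
proof (rule ccontr)
  assume neg: "\<not> ?thesis"
  let ?L = "topological_center G T"
  have regular: "completely_regular_space T"
    by (intro normal_imp_completely_regular_space_A compact_Hausdorff_or_regular_imp_normal_space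
        Hausdorff_imp_t1_space compact Hausdorff disjI1)
  obtain f where f: "continuous_map T euclideanreal f" "f g\<^sub>0 = 0"
    and f_img: "f ` (topspace T - W) \<subseteq> {1}"
    using regular[unfolded completely_regular_space_alt', rule_format, OF W] by auto
  have f1: "f x = 1" if "x \<in> carrier G" "x \<notin> W" for x
    using f_img that by (auto simp: topspace_eq_carrier)
  have open_lt: "openin T {x \<in> carrier G. f x < c}" and open_gt: "openin T {x \<in> carrier G. f x > c}" for c
    using openin_continuous_map_preimage[OF f(1), of "{..<c}"]
      openin_continuous_map_preimage[OF f(1), of "{c<..}"] by (auto simp: topspace_eq_carrier)
  have g0: "g\<^sub>0 \<in> carrier G" using W openin_subset topspace_eq_carrier by blast
  have dense: "\<exists>x\<in>?L. x \<in> U" if "openin T U" "U \<noteq> {}" for U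
    using that topological_center_dense by (metis IntE dense_intersects_open ex_in_conv)
  \<comment> \<open>First \<open>x\<close> moves into the center with \<open>k\<close> fixed (a right shift), then \<open>k\<close> with the new
      central \<open>g\<close> fixed (a left shift); only in this order are both shifts continuous.\<close>
  have center_jump: "\<exists>g\<in>?L. \<exists>h\<in>?L. h \<in> V \<and> f g < 1/4 \<and> f (g \<otimes> h) > 3/4" if V: "openin T V" "\<one> \<in> V" for V
  proof -
    have "g\<^sub>0 \<in> {x \<in> carrier G. f x < 1/4}"
      using f(2) g0 by simp
    then obtain x k where xk: "x \<in> {x \<in> carrier G. f x < 1/4}" "k \<in> V" "x \<otimes> k \<notin> W"
      using neg open_lt[of "1/4"] V by blast
    have k: "k \<in> carrier G" using xk(2) V(1) openin_subset topspace_eq_carrier by blast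
    let ?U = "{x \<in> carrier G. f x < 1/4} \<inter> {x \<in> carrier G. x \<otimes> k \<in> {x \<in> carrier G. f x > 3/4}}"
    have "openin T ?U"
      by (intro openin_Int open_lt open_gt openin_right_shift_vimage k)
    moreover have "x \<in> ?U" using xk k f1[of "x \<otimes> k"] by auto
    ultimately obtain g where g: "g \<in> ?L" "g \<in> ?U" using dense[of ?U] by blast
    let ?V = "V \<inter> {h \<in> carrier G. g \<otimes> h \<in> {x \<in> carrier G. f x > 3/4}}"
    have "openin T ?V"
      by (intro openin_Int V open_gt openin_left_shift_vimage g)
    moreover have "k \<in> ?V" using g k xk by auto
    ultimately obtain h where "h \<in> ?L" "h \<in> ?V" using dense[of ?V] by blast
    then show ?thesis using g by auto
  qed
  obtain D where D: "countable D" "D \<subseteq> ?L" "subgroup D G"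
    and jump: "\<And>P \<epsilon>. finite P \<Longrightarrow> P \<subseteq> D \<Longrightarrow> \<epsilon> > 0 \<Longrightarrow>
       \<exists>g\<in>D. \<exists>h\<in>D. (\<forall>p\<in>P. \<bar>f (p \<otimes> h) - f p\<bar> < \<epsilon>) \<and> f g < 1/4 \<and> f (g \<otimes> h) > 3/4"
    by (rule countable_subgroup_of_jumps[OF f(1) center_jump]) (assumption+, rule that)
  interpret D: subgroup D G by (rule D(3))
  have D_ne: "D \<noteq> {}" using D.one_closed by blast
  define s where "s = from_nat_into D"
  have s: "range s = D" "\<And>n. s n \<in> D"
  proof -
    show "range s = D" using range_from_nat_into[OF D_ne D(1)] by (simp add: s_def)
    then show "\<And>n. s n \<in> D" by blast
  qed
  have Dc: "D \<subseteq> carrier G" by (rule D.subset)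
  define \<Phi> where "\<Phi> h = (\<lambda>n. f (s n \<otimes> h))" for h
  have \<Phi>: "continuous_map T euclidean \<Phi>"
  proof -
    have "continuous_map T euclideanreal (\<lambda>h. \<Phi> h n)" for n
    proof -
      have "continuous_map T T (\<lambda>h. s n \<otimes> h)"
        using s(2) D(2) by (auto simp: topological_center_def)
      then have "continuous_map T euclideanreal (f \<circ> (\<lambda>h. s n \<otimes> h))"
        using f(1) by (rule continuous_map_compose)
      then show ?thesis by (simp add: \<Phi>_def comp_def)
    qed
    then show ?thesis
      unfolding euclidean_product_topology[symmetric] continuous_map_componentwise_UNIV by blast
  qed
  define K where "K = \<Phi> ` (T closure_of D)"
  have DK: "\<Phi> ` D \<subseteq> K"
    using closure_of_subset[of D T] Dc by (auto simp: K_def topspace_eq_carrier)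
  have dense_K: "\<exists>u\<in>D. \<Phi> u \<in> U" if U: "open U" "U \<inter> K \<noteq> {}" for U
  proof -
    obtain h where h: "h \<in> T closure_of D" "\<Phi> h \<in> U" using U(2) by (auto simp: K_def)
    have "openin T {h \<in> topspace T. \<Phi> h \<in> U}"
      by (rule openin_continuous_map_preimage[OF \<Phi>]) (use U(1) in simp)
    moreover have "h \<in> {h \<in> topspace T. \<Phi> h \<in> U}"
      by (intro CollectI conjI subsetD[OF closure_of_subset_topspace h(1)] h(2))
    ultimately have "\<exists>u. u \<in> D \<and> u \<in> {h \<in> topspace T. \<Phi> h \<in> U}"
      using h(1) by (metis (no_types, lifting) in_closure_of)
    then show ?thesis by auto
  qed
  let ?X = "top_of_set K"
  have "compactin euclidean K"
    unfolding K_def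
    by (rule image_compactin[OF closedin_compact_space[OF compact closedin_closure_of] \<Phi>])
  then have X: "compact_space ?X" "Hausdorff_space ?X" "topspace ?X \<noteq> {}"
    using DK D_ne by (auto simp: compact_space_subtopology intro!: Hausdorff_space_subtopology)
  have "\<Phi> ` D \<inter> V \<noteq> {}" if V: "openin ?X V" "V \<noteq> {}" for V
  proof -
    obtain U where "open U" "V = K \<inter> U" using V(1) unfolding openin_open by blast
    then show ?thesis using dense_K[of U] V(2) DK by blast
  qed
  then have "?X closure_of (\<Phi> ` D) = topspace ?X"
    unfolding dense_intersects_open by blast
  then have "separable_space ?X"
    using D(1) DK by (auto simp: separable_space_def)
  then have ccc: "ccc_space ?X"
    by (rule separable_space_imp_ccc_space)
  \<comment> \<open>The closed sets depend on a finite family \<open>F\<close> of basic open sets only through its union, which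
      separates small values from large ones.\<close>
  define C where "C F = K \<inter> {x. \<forall>n. if s n \<in> \<Union>F then x n \<le> 3/4 else x n \<ge> 1/4}" for F
  have C_closed: "closedin ?X (C F)" for F
  proof -
    have "closed {x :: nat \<Rightarrow> real. if s n \<in> \<Union>F then x n \<le> 3/4 else x n \<ge> 1/4}" for n
    proof -
      have "closed {x :: nat \<Rightarrow> real. x n \<le> 3/4}" "closed {x :: nat \<Rightarrow> real. x n \<ge> 1/4}"
        by (intro closed_Collect_le continuous_on_product_coordinates continuous_on_const)+
      then show ?thesis
        by (cases "s n \<in> \<Union>F") (simp_all only: if_True if_False)
    qed
    then show ?thesis
      unfolding C_def by (intro closedin_closed_Int closed_Collect_all) auto
  qed
  have "topspace ?X \<subseteq> (\<Union>F\<in>Fpow B. C F)"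
  proof
    fix x assume "x \<in> topspace ?X"
    then obtain h where h: "h \<in> T closure_of D" "x = \<Phi> h" "x \<in> K" by (auto simp: K_def)
    then have hc: "h \<in> carrier G"
      using closure_of_subset_topspace[of T D] by (auto simp: topspace_eq_carrier)
    have fh: "continuous_map T euclideanreal (\<lambda>g. f (g \<otimes> h))"
      using continuous_map_compose[OF continuous_right_shift[OF hc] f(1)] by (simp add: comp_def)
    have "closedin T {g \<in> topspace T. f (g \<otimes> h) \<in> {..1/4}}"
      by (rule closedin_continuous_map_preimage[OF fh]) simp
    moreover have "openin T {g \<in> topspace T. f (g \<otimes> h) \<in> {..<3/4}}"
      by (rule openin_continuous_map_preimage[OF fh]) simp
    moreover have "{g \<in> topspace T. f (g \<otimes> h) \<in> {..1/4}} \<subseteq> {g \<in> topspace T. f (g \<otimes> h) \<in> {..<3/4}}"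
      by auto
    ultimately obtain F where F: "F \<in> Fpow B"
      "{g \<in> topspace T. f (g \<otimes> h) \<in> {..1/4}} \<subseteq> \<Union>F" "\<Union>F \<subseteq> {g \<in> topspace T. f (g \<otimes> h) \<in> {..<3/4}}"
      by (rule compactin_between_base[OF base closedin_compact_space[OF compact]]) (rule that)
    have "if s n \<in> \<Union>F then x n \<le> 3/4 else x n \<ge> 1/4" for n
    proof (cases "s n \<in> \<Union>F")
      case True
      then have "f (s n \<otimes> h) < 3/4" using F(3) by auto
      then show ?thesis using True h(2) by (simp add: \<Phi>_def)
    next
      case False
      moreover have "s n \<in> topspace T" using s(2)[of n] Dc by (auto simp: topspace_eq_carrier)
      ultimately have "\<not> f (s n \<otimes> h) \<le> 1/4" using F(2) by auto
      then show ?thesis using False h(2) by (simp add: \<Phi>_def)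
    qed
    then show "x \<in> (\<Union>F\<in>Fpow B. C F)"
      using F(1) h(3) unfolding C_def by blast
  qed
  from MA_closed_cover_has_interior[OF MA X(3,1,2) ccc card C_closed this]
  obtain F where "?X interior_of C F \<noteq> {}" by metis
  then obtain x V where "openin ?X V" "x \<in> V" "V \<subseteq> C F"
    unfolding interior_of_def by blast
  then obtain U where U: "open U" "U \<inter> K \<noteq> {}" "K \<inter> U \<subseteq> C F"
    unfolding openin_open by blast
  obtain u where u: "u \<in> D" "\<Phi> u \<in> U" using dense_K[OF U(1,2)] by blast
  define J where "J k g h \<longleftrightarrow> g \<in> D \<and> h \<in> D \<and> f g < 1/4 \<and> f (g \<otimes> h) > 3/4 \<and>
      (\<forall>i\<in>{..k}. \<bar>f (s i \<otimes> u \<otimes> h) - f (s i \<otimes> u)\<bar> < 1 / Suc k)" for k g h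
  have "\<exists>g h. J k g h" for k
  proof -
    have "(\<lambda>i. s i \<otimes> u) ` {..k} \<subseteq> D" using s(2) u(1) by auto
    from jump[OF _ this, of "1 / Suc k"] show ?thesis by (auto simp: J_def)
  qed
  then obtain g h where J: "\<And>k. J k (g k) (h k)" by metis
  have gh: "g k \<in> D" "h k \<in> D" "f (g k) < 1/4" "f (g k \<otimes> h k) > 3/4" for k
    using J[of k] by (simp_all add: J_def)
  have near: "\<bar>f (s i \<otimes> u \<otimes> h k) - f (s i \<otimes> u)\<bar> < 1 / Suc k" if "i \<le> k" for i k
    using J[of k] that by (simp add: J_def)
  \<comment> \<open>In each coordinate the error bound \<open>1 / Suc k\<close> is in force from \<open>k = i\<close> on.\<close>
  have lim: "(\<lambda>k. \<Phi> (u \<otimes> h k) i) \<longlonglongrightarrow> \<Phi> u i" for i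
  proof (rule LIM_zero_cancel, rule Lim_null_comparison)
    show "\<forall>\<^sub>F k in sequentially. norm (\<Phi> (u \<otimes> h k) i - \<Phi> u i) \<le> 1 / Suc k"
      using eventually_ge_at_top[of i]
    proof eventually_elim
      case (elim k)
      have "s i \<otimes> (u \<otimes> h k) = s i \<otimes> u \<otimes> h k"
        using s(2) u(1) gh(2) Dc by (simp add: m_assoc subset_iff)
      then show ?case using near[OF elim] by (simp add: \<Phi>_def)
    qed
    show "(\<lambda>k. 1 / real (Suc k)) \<longlonglongrightarrow> 0"
      using LIMSEQ_inverse_real_of_nat by (simp add: inverse_eq_divide)
  qed
  have "limitin (product_topology (\<lambda>_. euclideanreal) UNIV) (\<lambda>k. \<Phi> (u \<otimes> h k)) (\<Phi> u) sequentially"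
    unfolding limitin_componentwise using lim by (simp add: PiE_UNIV_domain)
  then have "(\<lambda>k. \<Phi> (u \<otimes> h k)) \<longlonglongrightarrow> \<Phi> u"
    by (simp add: euclidean_product_topology)
  then have "\<forall>\<^sub>F k in sequentially. \<Phi> (u \<otimes> h k) \<in> U"
    using U(1) u(2) by (rule topological_tendstoD)
  then obtain k where k: "\<Phi> (u \<otimes> h k) \<in> U"
    by (auto simp: eventually_sequentially)
  have "g k \<otimes> inv u \<in> range s" unfolding s(1) using gh(1) u(1) by simp
  then obtain n where n: "s n = g k \<otimes> inv u" by auto
  have c: "u \<in> carrier G" "g k \<in> carrier G" "h k \<in> carrier G" using u(1) gh(1,2) Dc by auto
  have "g k \<otimes> inv u \<otimes> u = g k"
    using c by (simp add: m_assoc)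
  moreover from this have "g k \<otimes> inv u \<otimes> (u \<otimes> h k) = g k \<otimes> h k"
    using c by (simp flip: m_assoc)
  ultimately have "\<Phi> u n = f (g k)" "\<Phi> (u \<otimes> h k) n = f (g k \<otimes> h k)"
    by (simp_all add: \<Phi>_def n)
  moreover have in_C: "\<Phi> v \<in> C F" if "v \<in> D" "\<Phi> v \<in> U" for v
    by (rule subsetD[OF U(3)]) (use that DK in blast)
  have "\<Phi> u \<in> C F" "\<Phi> (u \<otimes> h k) \<in> C F"
    by (rule in_C[OF u], rule in_C[OF D.m_closed[OF u(1) gh(2)] k])
  then have "if s n \<in> \<Union>F then \<Phi> u n \<le> 3/4 else \<Phi> u n \<ge> 1/4"
    "if s n \<in> \<Union>F then \<Phi> (u \<otimes> h k) n \<le> 3/4 else \<Phi> (u \<otimes> h k) n \<ge> 1/4"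
    unfolding C_def by blast+
  \<comment> \<open>The value below \<open>1/4\<close> puts the index inside \<open>\<Union>F\<close>, the value above \<open>3/4\<close> outside.\<close>
  ultimately show False
    using gh(3,4)[of k] by (cases "s n \<in> \<Union>F") simp_all
qed

text \<open>A finite topology contains the intersection of all neighbourhoods of \<open>\<one>\<close>.\<close>

lemma finite_base_imp_open_one:
  assumes base: "is_base T B" and "finite B"
  shows "openin T {\<one>}"
proof -
  have "{U. openin T U} \<subseteq> Union ` Pow B"
    using base by (auto simp: is_base_def union_of_def image_iff subset_iff)
  then have "finite {U. openin T U}"
    using \<open>finite B\<close> by (meson finite_Pow_iff finite_imageI finite_subset)
  then have "openin T (\<Inter>{U. openin T U \<and> \<one> \<in> U})"
    using openin_topspace[of T]
    by (intro openin_Inter) (auto simp: topspace_eq_carrier elim: finite_subset[rotated])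
  moreover have "\<Inter>{U. openin T U \<and> \<one> \<in> U} = {\<one>}"
  proof -
    have "x = \<one>" if x: "x \<in> \<Inter>{U. openin T U \<and> \<one> \<in> U}" for x
    proof (rule ccontr)
      assume "x \<noteq> \<one>"
      moreover have "x \<in> carrier G" using x openin_topspace[of T] by (auto simp: topspace_eq_carrier)
      ultimately obtain U where "openin T U" "\<one> \<in> U" "x \<notin> U"
        using Hausdorff_imp_t1_space[OF Hausdorff] by (metis one_closed t1_space_def topspace_eq_carrier)
      then show False using x by blast
    qed
    then show ?thesis by blast
  qed
  ultimately show ?thesis by simp
qed

end

theorem theorem5:
  fixes G :: "('a, 'm) monoid_scheme" and T :: "'a topology" and \<tau> :: "'c rel"
  assumes "Card_order \<tau>"
    and "|Pow (Field \<tau>)| \<le>o |UNIV :: 'u set|"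
    and "MA TYPE('u) \<tau>"
    and "CHART_group G T"
    and "weight T \<le>o \<tau>"
  shows "topological_group G T"
proof -
  interpret CHART_group G T by fact
  obtain B where B: "is_base T B" "|B| \<le>o \<tau>"
    using weight_attained[of T] assms(5) by metis
  show ?thesis
  proof (rule topological_groupI_local)
    fix W g assume W: "openin T W" "g \<in> W"
    show "\<exists>N V. openin T N \<and> openin T V \<and> g \<in> N \<and> \<one>\<^bsub>G\<^esub> \<in> V \<and> (\<forall>x\<in>N. \<forall>h\<in>V. x \<otimes>\<^bsub>G\<^esub> h \<in> W)"
    proof (cases "finite (Field \<tau>)")
      case True
      then have "finite B"
        using B(2) assms(1) card_of_ordLeq_finite card_of_Field_ordIso ordIso_symmetric
          ordLeq_ordIso_trans by metis
      then have "openin T {\<one>\<^bsub>G\<^esub>}"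
        using finite_base_imp_open_one B(1) by blast
      moreover have "x \<otimes>\<^bsub>G\<^esub> \<one>\<^bsub>G\<^esub> \<in> W" if "x \<in> W" for x
        using that openin_subset[OF W(1)] by (simp add: topspace_eq_carrier subset_iff)
      ultimately show ?thesis using W by blast
    next
      case False
      have "MA TYPE(nat \<Rightarrow> real) \<tau>"
        by (rule MA_mono_type[OF assms(3)
              ordLeq_transitive[OF card_of_nat_fun_real_ordLeq_Pow[OF False] assms(2)]])
      then show ?thesis
        by (rule MA_jointly_continuous_at_one
            [OF _ B(1) card_of_Fpow_ordLeq_infinite[OF assms(1) False B(2)] W])
    qed
  qed
qed

end
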